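(* Let $k_{\min}:=K'(0)+\int_0^{\Phi_F}(K''(\phi))_-\,d\phi$ and suppose $k_{\min}>0$. Then every classical solution of system (S) blows up in finite time, except if the solution is the unique steady state of (S), when it exists.
   Context: Standing assumptions: $\Phi_F>0$ is fixed and $K\in C^2(\mathbb{R})$ is a function with $K',K''$ bounded on $\mathbb{R}$ and $K(\phi)>0$ for $\phi\in[0,\Phi_F]$. Notation: $(x)_-:=\min(x,0)$. System (S), for unknowns $Q(\tau,\eta)$ and $N(\tau)$: $$\partial_\tau Q+\partial_\eta Q=\frac1{N(\tau)}+K(Q)\quad(\tau>0,\ \eta\in(0,1)),\qquad Q(\tau,0)=0\quad(\tau>0),$$ $$\frac1{N(\tau)}=\partial_\eta Q(\tau,1)-K(\Phi_F)\quad(\tau>0),\qquad Q(0,\eta)=Q_{\mathrm{init}}(\eta)\quad(\eta\in[0,1]).$$ Classical solution: given $0<T\le+\infty$ and an initial datum $Q_{\mathrm{init}}\in C^1[0,1]$ that is increasing with $Q_{\mathrm{init}}(0)=0$, $Q_{\mathrm{init}}(1)=\Phi_F$ and $\frac{d}{d\eta}Q_{\mathrm{init}}(1)>K(\Phi_F)$, a pair $(Q,N)$ is a classical solution of (S) on $[0,T)$ if (1) $Q\in C^1([0,T)\times[0,1])$ is increasing in $\eta$ and $N\in C[0,T)$ is positive; (2) the equations of (S) hold in the classical sense for $\tau\in[0,T)$; (3) $K(\Phi_F)<\partial_\eta Q(\tau,1)<+\infty$ for all $\tau\in[0,T)$. Here "increasing" means non-decreasing. Each classical solution is considered on its maximal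 existence interval $[0,\tau^* )$, where $\tau^*$ is the supremum of all $T$ for which a classical solution on $[0,T)$ with the given initial datum exists; the classical solution with a given initial datum is unique. It "blows up in finite time" if $\tau^*<+\infty$ (in which case $N(\tau)\to+\infty$ as $\tau\to(\tau^* )^-$). A steady state of (S) is a time-independent classical solution, i.e. $(Q^*,N^* )$ with $Q^*\in C^1[0,1]$, $N^*\in(0,+\infty)$, $\frac{d}{d\eta}Q^*=K(Q^* )+\frac1{N^*}$ on $[0,1]$, $Q^*(0)=0$, $Q^*(1)=\Phi_F$. There is at most one steady state. *)

theory Defs
  imports "HOL-Analysis.Analysis"
begin

text \<open>
  \<open>C1_on A f f'\<close>: on the set \<open>A\<close> the function \<open>f\<close> is continuously differentiable with
  derivative \<open>f'\<close>. Derivatives are taken within \<open>A\<close>, hence one-sided at the end points of an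
  interval, so that the values of \<open>f\<close> outside \<open>A\<close> are irrelevant.
\<close>

definition C1_on :: "real set \<Rightarrow> (real \<Rightarrow> real) \<Rightarrow> (real \<Rightarrow> real) \<Rightarrow> bool" where
  "C1_on A f f' \<longleftrightarrow>
     (\<forall>x\<in>A. (f has_real_derivative f' x) (at x within A)) \<and> continuous_on A f'"

definition standing_assumptions :: "(real \<Rightarrow> real) \<Rightarrow> real \<Rightarrow> bool" where
  "standing_assumptions K \<Phi>F \<longleftrightarrow>
     \<Phi>F > 0 \<and>
     K differentiable_on UNIV \<and> deriv K differentiable_on UNIV \<and>
     continuous_on UNIV (deriv (deriv K)) \<and>
     bounded (range (deriv K)) \<and> bounded (range (deriv (deriv K))) \<and>
     (\<forall>\<phi>\<in>{0..\<Phi>F}. K \<phi> > 0)"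

definition initial_datum :: "(real \<Rightarrow> real) \<Rightarrow> real \<Rightarrow> (real \<Rightarrow> real) \<Rightarrow> bool" where
  "initial_datum K \<Phi>F Qinit \<longleftrightarrow>
     (\<exists>Q'. C1_on {0..1} Qinit Q' \<and> Q' 1 > K \<Phi>F) \<and>
     mono_on {0..1} Qinit \<and> Qinit 0 = 0 \<and> Qinit 1 = \<Phi>F"

text \<open>The time interval \<open>[0,T)\<close>, where \<open>T = \<infinity>\<close> is allowed.\<close>

definition time_interval :: "ereal \<Rightarrow> real set" where
  "time_interval T = {\<tau>. 0 \<le> \<tau> \<and> ereal \<tau> < T}"

text \<open>
  \<open>C1_strip T Q Q\<^sub>\<tau> Q\<^sub>\<eta>\<close>: \<open>Q\<close> is of class \<open>C\<^sup>1\<close> on \<open>[0,T) \<times> [0,1]\<close> with partial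
  derivatives \<open>Q\<^sub>\<tau>\<close> and \<open>Q\<^sub>\<eta>\<close>, one-sided on the boundary of the strip.
\<close>

definition C1_strip ::
    "ereal \<Rightarrow> (real \<Rightarrow> real \<Rightarrow> real) \<Rightarrow> (real \<Rightarrow> real \<Rightarrow> real) \<Rightarrow> (real \<Rightarrow> real \<Rightarrow> real) \<Rightarrow> bool" where
  "C1_strip T Q Q\<^sub>\<tau> Q\<^sub>\<eta> \<longleftrightarrow>
     (\<forall>\<tau>\<in>time_interval T. \<forall>\<eta>\<in>{0..1}.
        ((\<lambda>t. Q t \<eta>) has_real_derivative Q\<^sub>\<tau> \<tau> \<eta>) (at \<tau> within time_interval T) \<and>
        ((\<lambda>e. Q \<tau> e) has_real_derivative Q\<^sub>\<eta> \<tau> \<eta>) (at \<eta> within {0..1})) \<and>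
     continuous_on (time_interval T \<times> {0..1}) (\<lambda>(\<tau>, \<eta>). Q \<tau> \<eta>) \<and>
     continuous_on (time_interval T \<times> {0..1}) (\<lambda>(\<tau>, \<eta>). Q\<^sub>\<tau> \<tau> \<eta>) \<and>
     continuous_on (time_interval T \<times> {0..1}) (\<lambda>(\<tau>, \<eta>). Q\<^sub>\<eta> \<tau> \<eta>)"

text \<open>
  Since \<open>Q\<^sub>\<eta>\<close> is real-valued, the requirement \<open>Q\<^sub>\<eta>(\<tau>,1) < \<infinity>\<close> holds by typing.
\<close>

definition classical_solution ::
    "(real \<Rightarrow> real) \<Rightarrow> real \<Rightarrow> ereal \<Rightarrow> (real \<Rightarrow> real) \<Rightarrow>
     (real \<Rightarrow> real \<Rightarrow> real) \<Rightarrow> (real \<Rightarrow> real) \<Rightarrow> bool" where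
  "classical_solution K \<Phi>F T Qinit Q N \<longleftrightarrow> 0 < T \<and>
     (\<exists>Q\<^sub>\<tau> Q\<^sub>\<eta>. C1_strip T Q Q\<^sub>\<tau> Q\<^sub>\<eta> \<and>
        (\<forall>\<tau>\<in>time_interval T. mono_on {0..1} (Q \<tau>)) \<and>
        continuous_on (time_interval T) N \<and>
        (\<forall>\<tau>\<in>time_interval T. N \<tau> > 0) \<and>
        (\<forall>\<tau>\<in>time_interval T. \<forall>\<eta>\<in>{0<..<1}.
           Q\<^sub>\<tau> \<tau> \<eta> + Q\<^sub>\<eta> \<tau> \<eta> = 1 / N \<tau> + K (Q \<tau> \<eta>)) \<and>
        (\<forall>\<tau>\<in>time_interval T. Q \<tau> 0 = 0) \<and>
        (\<forall>\<tau>\<in>time_interval T. 1 / N \<tau> = Q\<^sub>\<eta> \<tau> 1 - K \<Phi>F) \<and>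
        (\<forall>\<eta>\<in>{0..1}. Q 0 \<eta> = Qinit \<eta>) \<and>
        (\<forall>\<tau>\<in>time_interval T. K \<Phi>F < Q\<^sub>\<eta> \<tau> 1))"

definition max_time :: "(real \<Rightarrow> real) \<Rightarrow> real \<Rightarrow> (real \<Rightarrow> real) \<Rightarrow> ereal" where
  "max_time K \<Phi>F Qinit = Sup {T. \<exists>Q N. classical_solution K \<Phi>F T Qinit Q N}"

definition maximal_classical_solution ::
    "(real \<Rightarrow> real) \<Rightarrow> real \<Rightarrow> (real \<Rightarrow> real) \<Rightarrow>
     (real \<Rightarrow> real \<Rightarrow> real) \<Rightarrow> (real \<Rightarrow> real) \<Rightarrow> bool" where
  "maximal_classical_solution K \<Phi>F Qinit Q N \<longleftrightarrow>
     classical_solution K \<Phi>F (max_time K \<Phi>F Qinit) Qinit Q N"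

definition blows_up_in_finite_time :: "(real \<Rightarrow> real) \<Rightarrow> real \<Rightarrow> (real \<Rightarrow> real) \<Rightarrow> bool" where
  "blows_up_in_finite_time K \<Phi>F Qinit \<longleftrightarrow> max_time K \<Phi>F Qinit < \<infinity>"

definition steady_state :: "(real \<Rightarrow> real) \<Rightarrow> real \<Rightarrow> (real \<Rightarrow> real) \<Rightarrow> real \<Rightarrow> bool" where
  "steady_state K \<Phi>F Qs Ns \<longleftrightarrow> Ns > 0 \<and>
     C1_on {0..1} Qs (\<lambda>\<eta>. K (Qs \<eta>) + 1 / Ns) \<and> Qs 0 = 0 \<and> Qs 1 = \<Phi>F"

text \<open>
  Steady states are compared as pairs of a function on \<open>[0,1]\<close> and a number; the values of
  \<open>Qs\<close> outside \<open>[0,1]\<close> carry no information.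
\<close>

definition unique_steady_state :: "(real \<Rightarrow> real) \<Rightarrow> real \<Rightarrow> (real \<Rightarrow> real) \<Rightarrow> real \<Rightarrow> bool" where
  "unique_steady_state K \<Phi>F Qs Ns \<longleftrightarrow> steady_state K \<Phi>F Qs Ns \<and>
     (\<forall>Qs' Ns'. steady_state K \<Phi>F Qs' Ns' \<longrightarrow>
        Ns' = Ns \<and> (\<forall>\<eta>\<in>{0..1}. Qs' \<eta> = Qs \<eta>))"

definition k_min :: "(real \<Rightarrow> real) \<Rightarrow> real \<Rightarrow> real" where
  "k_min K \<Phi>F = deriv K 0 + integral {0..\<Phi>F} (\<lambda>\<phi>. min (deriv (deriv K) \<phi>) 0)"

end

theory Submission
  imports Defs
begin

text \<open>
  The condition \<open>k_min K \<Phi>F > 0\<close> enters through \<open>K' \<ge> k_min K \<Phi>F\<close> on \<open>[0,\<Phi>F]\<close>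
  (\<open>k_min_le_deriv\<close>): neighbouring characteristics of the transport equation repel each other.
  The substance of the theorem is that this is incompatible with existence for all times, unless
  the solution is stationary.

  Let \<open>c = 1/N\<close> be the inverse rate of a global solution. The quantity \<open>R = c - Q\<^sub>\<tau>\<close>, which by the
  equation is also \<open>Q\<^sub>\<eta> - K(Q)\<close>, satisfies \<open>R' = K'(Q) (R - c)\<close> along characteristics. Since \<open>Q\<close> is
  constant in time at both ends of \<open>[0,1]\<close>, \<open>R\<close> enters the strip at time \<open>t\<close> with the value \<open>c(t)\<close>
  and leaves it at time \<open>t + 1\<close> with the value \<open>c(t + 1)\<close>. Let \<open>m \<ge> 0\<close> be the infimum of \<open>c\<close>; it
  exists because \<open>c\<close> is positive. If \<open>c(t)\<close> is within \<open>\<epsilon>\<close> of \<open>m\<close>, then the repulsion would push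
  \<open>R\<close> below \<open>m\<close> before time \<open>t + 1\<close>, unless \<open>c\<close> is close to \<open>m\<close> in the mean over \<open>[t,t+1]\<close>:
  the integral of \<open>c - m\<close> over this window is \<open>O(\<epsilon>)\<close> (\<open>near_infimum_window\<close>).

  On the other hand, every window of length one imposes the same constraint on \<open>c\<close>: the solution of
  \<open>y' = c(t + s) + K(y)\<close> with \<open>y(0) = 0\<close> reaches \<open>y(1) = \<Phi>F\<close>. Comparison of two windows shows that the
  integrals of \<open>c - m\<close> over them agree up to a fixed factor (\<open>window_comparison\<close>). Hence all these
  integrals vanish, and \<open>c\<close> is the constant \<open>m\<close> (\<open>c_constant\<close>). Then \<open>Q\<^sub>\<tau>\<close> solves a homogeneous
  linear equation along each characteristic and vanishes at its exit point, so it vanishes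
  everywhere (\<open>Q_time_derivative_zero\<close>). The solution is therefore a steady state, and steady states
  are unique because two of them can be compared in the same way (\<open>steady_state_unique\<close>).

  Conversely, a solution that coincides with a steady state extends to all times.
\<close>

section \<open>Linear scalar differential equations\<close>

lemma has_real_derivative_cong_on:
  assumes "x \<in> S" and "\<And>x. x \<in> S \<Longrightarrow> g x = f x" and "(f has_real_derivative D) (at x within S)"
  shows "(g has_real_derivative D) (at x within S)"
  using assms unfolding has_field_derivative_def by (rule has_derivative_transform)

lemma has_real_derivative_shift:
  assumes "(f has_real_derivative D) (at (x + a) within T)" and "(\<lambda>x. x + a) ` S \<subseteq> T"
  shows "((\<lambda>x. f (x + a)) has_real_derivative D) (at x within S)"
proof -
  have "((\<lambda>x. x + a) has_real_derivative 1) (at x within S)"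
    by (auto intro!: derivative_eq_intros)
  from DERIV_image_chain[OF DERIV_subset[OF assms] this] show ?thesis
    by (simp add: comp_def)
qed

lemma linear_ode_variation_of_constants:
  fixes a g y :: "real \<Rightarrow> real"
  assumes b: "0 \<le> b"
    and y: "\<And>s. s \<in> {0..b} \<Longrightarrow> (y has_real_derivative a s * y s + g s) (at s within {0..b})"
    and a: "continuous_on {0..b} a"
  shows "((\<lambda>s. exp (- integral {0..s} a) * g s) has_integral
      exp (- integral {0..b} a) * y b - y 0) {0..b}"
proof -
  let ?E = "\<lambda>s. exp (- integral {0..s} a)"
  have "((\<lambda>s. ?E s * y s) has_real_derivative ?E s * g s) (at s within {0..b})"
    if "s \<in> {0..b}" for s
    by (rule derivative_eq_intros y[OF that] integral_has_real_derivative[OF a that] refl)+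
      (simp add: algebra_simps)
  then have "((\<lambda>s. ?E s * g s) has_integral ?E b * y b - ?E 0 * y 0) {0..b}"
    using b by (intro fundamental_theorem_of_calculus)
      (auto simp: has_real_derivative_iff_has_vector_derivative)
  then show ?thesis by simp
qed

text \<open>
  The zero at either end forces the zero at the other, so the lemma serves both as forward and as
  backward uniqueness.
\<close>

lemma homogeneous_linear_ode_zero_iff:
  fixes a y :: "real \<Rightarrow> real"
  assumes "0 \<le> b"
    and "\<And>s. s \<in> {0..b} \<Longrightarrow> (y has_real_derivative a s * y s) (at s within {0..b})"
    and "continuous_on {0..b} a"
  shows "y b = 0 \<longleftrightarrow> y 0 = 0"
proof -
  have "((\<lambda>s. exp (- integral {0..s} a) * 0) has_integral
      exp (- integral {0..b} a) * y b - y 0) {0..b}"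
    using assms by (intro linear_ode_variation_of_constants) auto
  then have "exp (- integral {0..b} a) * y b = y 0"
    using has_integral_is_0[of "{0..b}" "\<lambda>_. 0"] has_integral_unique by fastforce
  then show ?thesis by auto
qed

lemma abs_integral_le_of_unit_length:
  fixes a :: "real \<Rightarrow> real"
  assumes a: "continuous_on {0..s} a" and s: "0 \<le> s" "s \<le> 1"
    and le: "\<And>r. r \<in> {0..s} \<Longrightarrow> \<bar>a r\<bar> \<le> L"
  shows "\<bar>integral {0..s} a\<bar> \<le> L"
proof -
  have L: "0 \<le> L" using le[of 0] s by auto
  have "norm (integral {0..s} a) \<le> L * (s - 0)"
    using a s le by (intro integral_bound) auto
  also have "\<dots> \<le> L" using s L by (simp add: mult_left_le)
  finally show ?thesis by simp
qed

section \<open>Difference quotients as averaged derivatives\<close>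

text \<open>
  As an integral, unlike as a quotient, this is continuous across the diagonal \<open>x = y\<close>. It turns the
  equation for the difference of two solutions of a nonlinear equation into a linear one with a
  continuous coefficient.
\<close>

definition mean_slope :: "(real \<Rightarrow> real) \<Rightarrow> real \<Rightarrow> real \<Rightarrow> real" where
  "mean_slope K' x y = integral {0..1} (\<lambda>\<theta>. K' (x + \<theta> * (y - x)))"

lemma mean_slope:
  assumes K: "\<And>x. (K has_real_derivative K' x) (at x)"
    and K': "continuous_on UNIV K'"
  shows "K y - K x = mean_slope K' x y * (y - x)"
proof -
  have "((\<lambda>\<theta>. K' (x + \<theta> * (y - x)) * (y - x)) has_integral
      K (x + 1 * (y - x)) - K (x + 0 * (y - x))) {0..1}"
    by (intro fundamental_theorem_of_calculus)
      (auto simp flip: has_real_derivative_iff_has_vector_derivative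
        intro!: derivative_eq_intros DERIV_chain2[OF K])
  from integral_unique[OF this] show ?thesis by (simp add: mean_slope_def)
qed

lemma continuous_on_mean_slope:
  fixes f g :: "'a::topological_space \<Rightarrow> real"
  assumes K': "continuous_on UNIV K'" and f: "continuous_on S f" and g: "continuous_on S g"
  shows "continuous_on S (\<lambda>s. mean_slope K' (f s) (g s))"
proof -
  have "continuous_on UNIV (\<lambda>p. integral (cbox 0 1) (\<lambda>\<theta>. K' (fst p + \<theta> * (snd p - fst p))))"
    by (intro integral_continuous_on_param)
      (auto simp: split_beta intro!: continuous_intros continuous_on_compose2[OF K'])
  then have "continuous_on UNIV (\<lambda>p. mean_slope K' (fst p) (snd p))"
    by (simp add: mean_slope_def)
  from continuous_on_compose2[OF this continuous_on_Pair[OF f g]] show ?thesis by simp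
qed

lemma abs_mean_slope_le:
  assumes K': "continuous_on UNIV K'" and le: "\<And>x. \<bar>K' x\<bar> \<le> L"
  shows "\<bar>mean_slope K' x y\<bar> \<le> L"
  unfolding mean_slope_def using le
  by (intro abs_integral_le_of_unit_length)
    (auto intro!: continuous_intros continuous_on_compose2[OF K'])

section \<open>Global solutions with increasing nonlinearity\<close>

text \<open>
  A classical solution on \<open>[0,\<infinity>)\<close> whose nonlinearity has slope at least \<open>k > 0\<close> on the range
  \<open>[0,\<Phi>]\<close>, written in terms of \<open>c = 1/N\<close>.
\<close>

locale global_solution =
  fixes K K' :: "real \<Rightarrow> real" and \<Phi> L k :: real
    and Q Q\<^sub>\<tau> Q\<^sub>\<eta> :: "real \<Rightarrow> real \<Rightarrow> real" and c :: "real \<Rightarrow> real"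
  assumes K: "\<And>x. (K has_real_derivative K' x) (at x)"
    and K'_cont: "continuous_on UNIV K'"
    and K'_bound: "\<And>x. \<bar>K' x\<bar> \<le> L"
    and k_pos: "k > 0"
    and K'_lower: "\<And>x. x \<in> {0..\<Phi>} \<Longrightarrow> k \<le> K' x"
    and Q\<^sub>\<tau>: "\<And>t e. t \<in> {0..} \<Longrightarrow> e \<in> {0..1} \<Longrightarrow>
      ((\<lambda>t. Q t e) has_real_derivative Q\<^sub>\<tau> t e) (at t within {0..})"
    and Q\<^sub>\<eta>: "\<And>t e. t \<in> {0..} \<Longrightarrow> e \<in> {0..1} \<Longrightarrow>
      (Q t has_real_derivative Q\<^sub>\<eta> t e) (at e within {0..1})"
    and Q_cont: "continuous_on ({0..} \<times> {0..1}) (\<lambda>(t, e). Q t e)"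
    and Q\<^sub>\<tau>_cont: "continuous_on ({0..} \<times> {0..1}) (\<lambda>(t, e). Q\<^sub>\<tau> t e)"
    and Q\<^sub>\<eta>_cont: "continuous_on ({0..} \<times> {0..1}) (\<lambda>(t, e). Q\<^sub>\<eta> t e)"
    and mono: "\<And>t. t \<in> {0..} \<Longrightarrow> mono_on {0..1} (Q t)"
    and c_cont: "continuous_on {0..} c"
    and c_pos: "\<And>t. t \<in> {0..} \<Longrightarrow> c t > 0"
    and pde_interior: "\<And>t e. t \<in> {0..} \<Longrightarrow> e \<in> {0<..<1} \<Longrightarrow> Q\<^sub>\<tau> t e + Q\<^sub>\<eta> t e = c t + K (Q t e)"
    and Q_left: "\<And>t. t \<in> {0..} \<Longrightarrow> Q t 0 = 0"
    and Q\<^sub>\<eta>_right: "\<And>t. t \<in> {0..} \<Longrightarrow> Q\<^sub>\<eta> t 1 = c t + K \<Phi>"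
    and Q_init_right: "Q 0 1 = \<Phi>"
begin

lemma continuous_on_along:
  assumes F: "continuous_on ({0..} \<times> {0..1}) (\<lambda>(t, e). F t e)"
    and f: "continuous_on S f" "f ` S \<subseteq> {0..}" and g: "continuous_on S g" "g ` S \<subseteq> {0..1}"
  shows "continuous_on S (\<lambda>s. F (f s) (g s) :: real)"
proof -
  have "(\<lambda>s. (f s, g s)) ` S \<subseteq> {0..} \<times> {0..1}"
    using f(2) g(2) by (simp add: image_subset_iff)
  from continuous_on_compose2[OF F continuous_on_Pair[OF f(1) g(1)] this] show ?thesis by simp
qed

lemma K_cont: "continuous_on A K"
  using K by (meson DERIV_continuous continuous_at_imp_continuous_on)

text \<open>
  The equation extends to the two ends of the space interval because all its terms are continuous.
\<close>

lemma pde: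
  assumes t: "t \<in> {0..}" and e: "e \<in> {0..1}"
  shows "Q\<^sub>\<tau> t e + Q\<^sub>\<eta> t e = c t + K (Q t e)"
proof -
  let ?h = "\<lambda>e. Q\<^sub>\<tau> t e + Q\<^sub>\<eta> t e - (c t + K (Q t e))"
  have Qt: "continuous_on {0..1} (\<lambda>e. Q t e)"
    using t by (intro continuous_on_along[OF Q_cont]) auto
  have "continuous_on {0..1} ?h"
    using t by (intro continuous_intros continuous_on_along[OF Q\<^sub>\<tau>_cont]
        continuous_on_along[OF Q\<^sub>\<eta>_cont] continuous_on_compose2[OF K_cont Qt]) auto
  then have "?h e = 0"
    using continuous_constant_on_closure[of "{0<..<1}" ?h 0 e] pde_interior[OF t] e by simp
  then show ?thesis by simp
qed

text \<open>
  At \<open>\<eta> = 1\<close> the boundary condition eliminates \<open>c\<close> and leaves \<open>q' = K(q) - K(\<Phi>)\<close> for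
  \<open>q(t) = Q(t,1)\<close>, of which \<open>\<Phi>\<close> is an equilibrium.
\<close>

lemma Q_right:
  assumes t: "t \<in> {0..}"
  shows "Q t 1 = \<Phi>"
proof -
  have "((\<lambda>t. Q t 1 - \<Phi>) has_real_derivative mean_slope K' \<Phi> (Q s 1) * (Q s 1 - \<Phi>))
      (at s within {0..t})" if s: "s \<in> {0..t}" for s
  proof -
    have "Q\<^sub>\<tau> s 1 = K (Q s 1) - K \<Phi>"
      using pde[of s 1] Q\<^sub>\<eta>_right[of s] s by simp
    then have "Q\<^sub>\<tau> s 1 = mean_slope K' \<Phi> (Q s 1) * (Q s 1 - \<Phi>)"
      using mean_slope[OF K K'_cont] by simp
    moreover have "((\<lambda>t. Q t 1) has_real_derivative Q\<^sub>\<tau> s 1) (at s within {0..t})"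
      by (rule DERIV_subset[OF Q\<^sub>\<tau>]) (use s in auto)
    ultimately show ?thesis by (auto intro!: derivative_eq_intros)
  qed
  moreover have "continuous_on {0..t} (\<lambda>s. mean_slope K' \<Phi> (Q s 1))"
    by (intro continuous_on_mean_slope K'_cont continuous_intros continuous_on_along[OF Q_cont]) auto
  ultimately have "Q t 1 - \<Phi> = 0 \<longleftrightarrow> Q 0 1 - \<Phi> = 0"
    using t by (intro homogeneous_linear_ode_zero_iff) auto
  then show ?thesis using Q_init_right by simp
qed

lemma Q_range:
  assumes "t \<in> {0..}" "e \<in> {0..1}"
  shows "Q t e \<in> {0..\<Phi>}"
proof -
  have "Q t 0 \<le> Q t e" "Q t e \<le> Q t 1"
    using mono_onD[OF mono[OF assms(1)]] assms(2) by simp_all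
  then show ?thesis by (simp add: Q_left[OF assms(1)] Q_right[OF assms(1)])
qed

lemma time_derivative_unique:
  assumes "(f has_real_derivative u) (at t within {0..})"
    and "(f has_real_derivative v) (at t within {0..})" and "t \<in> {0..}"
  shows "u = v"
proof (rule vector_derivative_unique_within_closed_interval)
  show "(f has_vector_derivative u) (at t within cbox t (t + 1))"
    "(f has_vector_derivative v) (at t within cbox t (t + 1))"
    using DERIV_subset[OF assms(1), of "{t..t+1}"] DERIV_subset[OF assms(2), of "{t..t+1}"] assms(3)
    by (simp_all add: has_real_derivative_iff_has_vector_derivative)
qed auto

lemma Q_left_derivative:
  assumes "t \<in> {0..}"
  shows "Q\<^sub>\<tau> t 0 = 0"
proof (rule time_derivative_unique)
  show "((\<lambda>t. Q t 0) has_real_derivative 0) (at t within {0..})"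
    by (rule has_real_derivative_cong_on[of t _ _ "\<lambda>_. 0"]) (use assms Q_left in auto)
qed (use assms Q\<^sub>\<tau> in auto)

lemma Q_right_derivative:
  assumes "t \<in> {0..}"
  shows "Q\<^sub>\<tau> t 1 = 0"
proof (rule time_derivative_unique)
  show "((\<lambda>t. Q t 1) has_real_derivative 0) (at t within {0..})"
    by (rule has_real_derivative_cong_on[of t _ _ "\<lambda>_. \<Phi>"]) (use assms Q_right in auto)
qed (use assms Q\<^sub>\<tau> in auto)

subsection \<open>Characteristics\<close>

lemma Q_total_derivative:
  assumes t: "t \<in> {0..}" and e: "e \<in> {0..1}"
  shows "((\<lambda>(t, e). Q t e) has_derivative (\<lambda>(u, v). Q\<^sub>\<tau> t e * u + Q\<^sub>\<eta> t e * v))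
    (at (t, e) within {0..} \<times> {0..1})"
proof -
  have "((\<lambda>(t, e). Q t e) has_derivative
      (\<lambda>(u, v). Q\<^sub>\<tau> t e * u + blinfun_mult_right (Q\<^sub>\<eta> t e) v)) (at (t, e) within {0..} \<times> {0..1})"
  proof (rule has_derivative_partialsI)
    have "continuous_on ({0..} \<times> {0..1}) (\<lambda>p. blinfun_mult_right (case p of (x, y) \<Rightarrow> Q\<^sub>\<eta> x y))"
      by (intro bounded_linear.continuous_on[OF bounded_linear_blinfun_mult_right] Q\<^sub>\<eta>_cont)
    then have "continuous_on ({0..} \<times> {0..1}) (\<lambda>(x, y). blinfun_mult_right (Q\<^sub>\<eta> x y))"
      by (simp add: split_beta)
    then show "continuous (at (t, e) within {0..} \<times> {0..1}) (\<lambda>(x, y). blinfun_mult_right (Q\<^sub>\<eta> x y))"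
      using t e by (simp add: continuous_on_eq_continuous_within)
  qed (use t e Q\<^sub>\<tau> Q\<^sub>\<eta> in \<open>auto simp: has_field_derivative_def\<close>)
  then show ?thesis by simp
qed

lemma Q_along_characteristic:
  assumes t: "t \<in> {0..}" and e: "e \<in> {0..1}" and b: "e + b \<le> 1" and s: "s \<in> {0..b}"
  shows "((\<lambda>s. Q (t + s) (e + s)) has_real_derivative c (t + s) + K (Q (t + s) (e + s)))
    (at s within {0..b})"
proof -
  have "((\<lambda>s. (\<lambda>(t, e). Q t e) (t + s, e + s)) has_derivative
      (\<lambda>h. (\<lambda>(u, v). Q\<^sub>\<tau> (t + s) (e + s) * u + Q\<^sub>\<eta> (t + s) (e + s) * v) (h, h))) (at s within {0..b})"
  proof (rule has_derivative_in_compose[where f = "\<lambda>s. (t + s, e + s)", unfolded comp_def])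
    show "((\<lambda>s. (t + s, e + s)) has_derivative (\<lambda>h. (h, h))) (at s within {0..b})"
      by (auto intro!: derivative_eq_intros)
    show "((\<lambda>(t, e). Q t e) has_derivative
        (\<lambda>(u, v). Q\<^sub>\<tau> (t + s) (e + s) * u + Q\<^sub>\<eta> (t + s) (e + s) * v))
        (at (t + s, e + s) within (\<lambda>s. (t + s, e + s)) ` {0..b})"
      by (rule has_derivative_subset[OF Q_total_derivative]) (use assms in auto)
  qed
  then have "((\<lambda>s. Q (t + s) (e + s)) has_real_derivative
      Q\<^sub>\<tau> (t + s) (e + s) + Q\<^sub>\<eta> (t + s) (e + s)) (at s within {0..b})"
    unfolding has_field_derivative_def prod.case by (rule has_derivative_eq_rhs) (auto simp: algebra_simps)
  then show ?thesis using pde[of "t + s" "e + s"] assms by simp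
qed

text \<open>
  This is the integrated form of \<open>R' = K'(Q) (R - c)\<close> for \<open>R = c - Q\<^sub>\<tau>\<close>. As \<open>Q\<close> has only first
  derivatives, the equation cannot be differentiated. Instead, it is integrated along the
  characteristic that starts at \<open>(t,e)\<close>, and the resulting identity is differentiated with respect
  to the starting time \<open>t\<close>. A shift in time keeps the characteristic in the strip even when it runs
  from \<open>\<eta> = 0\<close> to \<open>\<eta> = 1\<close>.
\<close>

lemma flux_increment:
  assumes t: "t \<in> {0..}" and e: "e \<in> {0..1}" and s: "0 \<le> s" "e + s \<le> 1"
  shows "Q\<^sub>\<tau> (t + s) (e + s) - c (t + s) - (Q\<^sub>\<tau> t e - c t) =
    integral {0..s} (\<lambda>r. K' (Q (t + r) (e + r)) * Q\<^sub>\<tau> (t + r) (e + r))"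
proof (rule time_derivative_unique)
  let ?C = "\<lambda>t. integral {0..t} c"
  \<comment> \<open>Subtracting the primitive of \<open>c\<close> leaves an integrand that is differentiable in the starting time.\<close>
  let ?G = "\<lambda>t. Q (t + s) (e + s) - ?C (t + s) - (Q t e - ?C t)"
  have C: "(?C has_real_derivative c u) (at u within {0..})" if u: "u \<in> {0..}" for u
  proof -
    have "(?C has_real_derivative c u) (at u within {0..u+1})"
      using u by (intro integral_has_real_derivative continuous_on_subset[OF c_cont]) auto
    moreover have "at u within {0..u+1} = at u within {0..}"
      by (rule at_within_nhd[of _ "{u-1<..<u+1}"]) auto
    ultimately show ?thesis by simp
  qed
  show "(?G has_real_derivative Q\<^sub>\<tau> (t + s) (e + s) - c (t + s) - (Q\<^sub>\<tau> t e - c t)) (at t within {0..})"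
    using t e s
    by (intro DERIV_diff C has_real_derivative_shift[OF Q\<^sub>\<tau>] has_real_derivative_shift[OF C] Q\<^sub>\<tau>) auto
  have G: "?G u = integral (cbox 0 s) (\<lambda>r. K (Q (u + r) (e + r)))" if u: "u \<in> {0..}" for u
  proof -
    have "((\<lambda>r. Q (u + r) (e + r) - ?C (u + r)) has_real_derivative K (Q (u + r) (e + r)))
        (at r within {0..s})" if r: "r \<in> {0..s}" for r
    proof -
      have "((\<lambda>r. ?C (r + u)) has_real_derivative c (r + u)) (at r within {0..s})"
        by (rule has_real_derivative_shift[OF C]) (use u r in auto)
      then have "((\<lambda>r. ?C (u + r)) has_real_derivative c (u + r)) (at r within {0..s})"
        by (simp only: add.commute)
      from DERIV_diff[OF Q_along_characteristic[OF u e s(2) r] this] show ?thesis by simp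
    qed
    then have "((\<lambda>r. K (Q (u + r) (e + r))) has_integral
        (Q (u + s) (e + s) - ?C (u + s)) - (Q (u + 0) (e + 0) - ?C (u + 0))) {0..s}"
      using s by (intro fundamental_theorem_of_calculus)
        (auto simp: has_real_derivative_iff_has_vector_derivative)
    then show ?thesis by (simp add: integral_unique)
  qed
  have "((\<lambda>u. integral (cbox 0 s) (\<lambda>r. K (Q (u + r) (e + r)))) has_real_derivative
      integral (cbox 0 s) (\<lambda>r. K' (Q (t + r) (e + r)) * Q\<^sub>\<tau> (t + r) (e + r))) (at t within {0..})"
  proof (rule leibniz_rule_field_derivative)
    fix u r :: real assume u: "u \<in> {0..}" and r: "r \<in> cbox 0 s"
    have "((\<lambda>u. Q (u + r) (e + r)) has_real_derivative Q\<^sub>\<tau> (u + r) (e + r)) (at u within {0..})"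
      by (rule has_real_derivative_shift[OF Q\<^sub>\<tau>]) (use u r e s in auto)
    from DERIV_chain2[OF K this]
    show "((\<lambda>u. K (Q (u + r) (e + r))) has_real_derivative
        K' (Q (u + r) (e + r)) * Q\<^sub>\<tau> (u + r) (e + r)) (at u within {0..})" .
  next
    fix u :: real assume "u \<in> {0..}"
    then show "(\<lambda>r. K (Q (u + r) (e + r))) integrable_on cbox 0 s"
      using e s by (intro integrable_continuous continuous_on_compose2[OF K_cont]
          continuous_on_along[OF Q_cont] continuous_intros) auto
  next
    show "continuous_on ({0..} \<times> cbox 0 s) (\<lambda>(u, r). K' (Q (u + r) (e + r)) * Q\<^sub>\<tau> (u + r) (e + r))"
      unfolding split_beta using e s
      by (intro continuous_intros continuous_on_compose2[OF K'_cont]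
          continuous_on_along[OF Q_cont] continuous_on_along[OF Q\<^sub>\<tau>_cont]) auto
  qed (use t in auto)
  from has_real_derivative_cong_on[OF t G this]
  show "(?G has_real_derivative
      integral {0..s} (\<lambda>r. K' (Q (t + r) (e + r)) * Q\<^sub>\<tau> (t + r) (e + r))) (at t within {0..})"
    by simp
qed (use t in auto)

lemma flux_along_characteristic:
  assumes t: "t \<in> {0..}" and e: "e \<in> {0..1}" and b: "e + b \<le> 1" and s: "s \<in> {0..b}"
  shows "((\<lambda>s. c (t + s) - Q\<^sub>\<tau> (t + s) (e + s)) has_real_derivative
    - (K' (Q (t + s) (e + s)) * Q\<^sub>\<tau> (t + s) (e + s))) (at s within {0..b})"
proof -
  let ?I = "\<lambda>s. integral {0..s} (\<lambda>r. K' (Q (t + r) (e + r)) * Q\<^sub>\<tau> (t + r) (e + r))"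
  have "(?I has_real_derivative K' (Q (t + s) (e + s)) * Q\<^sub>\<tau> (t + s) (e + s)) (at s within {0..b})"
    using assms
    by (intro integral_has_real_derivative continuous_intros continuous_on_compose2[OF K'_cont]
        continuous_on_along[OF Q_cont] continuous_on_along[OF Q\<^sub>\<tau>_cont]) auto
  then have "((\<lambda>s. c t - Q\<^sub>\<tau> t e - ?I s) has_real_derivative
      - (K' (Q (t + s) (e + s)) * Q\<^sub>\<tau> (t + s) (e + s))) (at s within {0..b})"
    by (auto intro!: derivative_eq_intros)
  then show ?thesis
    by (rule has_real_derivative_cong_on[OF s, rotated])
      (use b flux_increment[OF t e] in force)
qed

subsection \<open>The inverse firing rate is constant\<close>

text \<open>
  For \<open>g = R - m\<close> and \<open>d = c - m \<ge> 0\<close> the equation reads \<open>g' = K'(Q) (g - d)\<close>. On the characteristic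
  from \<open>(t,0)\<close> to \<open>(t+1,1)\<close>, variation of constants bounds a weighted integral of \<open>d\<close> by
  \<open>g(0) = c(t) - m\<close>, because \<open>g(1) = c(t+1) - m\<close> is not negative. The weight is at least
  \<open>k exp(-L)\<close>; this is where the repulsion of characteristics is used.
\<close>

lemma near_infimum_window:
  assumes m: "\<And>t. t \<in> {0..} \<Longrightarrow> m \<le> c t" and t: "t \<in> {0..}"
  shows "integral {0..1} (\<lambda>s. c (t + s) - m) \<le> exp L / k * (c t - m)"
proof -
  define a where "a = (\<lambda>s. K' (Q (t + s) s))"
  define d where "d = (\<lambda>s. c (t + s) - m)"
  define f where "f = (\<lambda>s. c (t + s) - Q\<^sub>\<tau> (t + s) s)"
  define A where "A = (\<lambda>s. integral {0..s} a)"
  have a_cont: "continuous_on {0..1} a" unfolding a_def using t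
    by (intro continuous_on_compose2[OF K'_cont] continuous_on_along[OF Q_cont] continuous_intros) auto
  have d_cont: "continuous_on {0..1} d" unfolding d_def using t
    by (intro continuous_intros continuous_on_compose2[OF c_cont]) auto
  have d_nonneg: "0 \<le> d s" if "s \<in> {0..1}" for s using m that t unfolding d_def by auto
  have int: "((\<lambda>s. exp (- A s) * (- a s * d s)) has_integral exp (- A 1) * (f 1 - m) - (f 0 - m)) {0..1}"
    unfolding A_def
  proof (rule linear_ode_variation_of_constants)
    fix s :: real assume s: "s \<in> {0..1}"
    have "(f has_real_derivative - (a s * Q\<^sub>\<tau> (t + s) s)) (at s within {0..1})"
      using flux_along_characteristic[OF t, of 0 1 s] s by (simp add: f_def a_def)
    from DERIV_diff[OF this DERIV_const[of m]]
    show "((\<lambda>s. f s - m) has_real_derivative a s * (f s - m) + - a s * d s) (at s within {0..1})"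
      by (simp add: f_def d_def algebra_simps)
  qed (use a_cont in auto)
  have "exp (- L) * k * d s \<le> exp (- A s) * (a s * d s)" if s: "s \<in> {0..1}" for s
  proof -
    have "\<bar>A s\<bar> \<le> L" unfolding A_def
      using s K'_bound a_def
      by (intro abs_integral_le_of_unit_length continuous_on_subset[OF a_cont]) auto
    moreover have "k \<le> a s" unfolding a_def using s t by (intro K'_lower Q_range) auto
    ultimately have "exp (- L) * k \<le> exp (- A s) * a s"
      using k_pos by (intro mult_mono) auto
    from mult_right_mono[OF this d_nonneg[OF s]] show ?thesis by (simp add: mult.assoc)
  qed
  moreover have "((\<lambda>s. exp (- L) * k * d s) has_integral exp (- L) * k * integral {0..1} d) {0..1}"
    using d_cont by (intro has_integral_mult_right integrable_integral integrable_continuous_real)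
  moreover have "((\<lambda>s. exp (- A s) * (a s * d s)) has_integral (f 0 - m) - exp (- A 1) * (f 1 - m)) {0..1}"
    using has_integral_neg[OF int] by simp
  ultimately have "exp (- L) * k * integral {0..1} d \<le> (f 0 - m) - exp (- A 1) * (f 1 - m)"
    by (rule has_integral_le[rotated -1])
  also have "\<dots> \<le> c t - m"
    using Q_left_derivative[OF t] Q_right_derivative[of "t + 1"] m[of "t + 1"] t
    by (simp add: f_def)
  finally show ?thesis using k_pos unfolding d_def by (simp add: exp_minus field_simps)
qed

text \<open>
  The difference of \<open>Q\<close> along the characteristics starting at \<open>(u,0)\<close> and \<open>(t,0)\<close> vanishes at both
  ends and solves a linear equation with inhomogeneity \<open>c(u + s) - c(t + s)\<close>. So the integrals of
  \<open>c - m\<close> over both windows agree when taken with the weight \<open>exp(-A)\<close>, which lies between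
  \<open>exp(-L)\<close> and \<open>exp L\<close>.
\<close>

lemma window_comparison:
  assumes m: "\<And>t. t \<in> {0..} \<Longrightarrow> m \<le> c t" and t: "t \<in> {0..}" and u: "u \<in> {0..}"
  shows "integral {0..1} (\<lambda>s. c (u + s) - m) \<le> exp (2 * L) * integral {0..1} (\<lambda>s. c (t + s) - m)"
proof -
  define a where "a = (\<lambda>s. mean_slope K' (Q (t + s) s) (Q (u + s) s))"
  define A where "A = (\<lambda>s. integral {0..s} a)"
  define d where "d = (\<lambda>t s. c (t + s) - m)"
  define D where "D = (\<lambda>s. Q (u + s) s - Q (t + s) s)"
  have a_cont: "continuous_on {0..1} a" unfolding a_def using t u
    by (intro continuous_on_mean_slope K'_cont continuous_on_along[OF Q_cont] continuous_intros) auto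
  have A_cont: "continuous_on {0..1} A" unfolding A_def
    using a_cont by (intro indefinite_integral_continuous_1 integrable_continuous_real)
  have d_cont: "continuous_on {0..1} (d v)" if "v \<in> {0..}" for v unfolding d_def using that
    by (intro continuous_intros continuous_on_compose2[OF c_cont]) auto
  have d_nonneg: "0 \<le> d v s" if "s \<in> {0..1}" "v \<in> {0..}" for s v
    using m that unfolding d_def by auto
  have A_le: "\<bar>A s\<bar> \<le> L" if "s \<in> {0..1}" for s unfolding A_def
    using that abs_mean_slope_le[OF K'_cont K'_bound] a_def
    by (intro abs_integral_le_of_unit_length continuous_on_subset[OF a_cont]) auto
  have E_int: "((\<lambda>s. exp (- A s) * d v s) has_integral integral {0..1} (\<lambda>s. exp (- A s) * d v s)) {0..1}"
    if "v \<in> {0..}" for v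
    using d_cont[OF that] A_cont
    by (intro integrable_integral integrable_continuous_real continuous_intros)
  have d_int: "((\<lambda>s. x * d v s) has_integral x * integral {0..1} (d v)) {0..1}"
    if "v \<in> {0..}" for x v
    using d_cont[OF that]
    by (intro has_integral_mult_right integrable_integral integrable_continuous_real)
  have int_D: "((\<lambda>s. exp (- A s) * (d u s - d t s)) has_integral exp (- A 1) * D 1 - D 0) {0..1}"
    unfolding A_def
  proof (rule linear_ode_variation_of_constants)
    fix s :: real assume s: "s \<in> {0..1}"
    have "a s * D s = K (Q (u + s) s) - K (Q (t + s) s)"
      unfolding a_def D_def by (rule mean_slope[OF K K'_cont, symmetric])
    moreover have "(D has_real_derivative c (u + s) + K (Q (u + s) s) - (c (t + s) + K (Q (t + s) s)))
        (at s within {0..1})"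
      using DERIV_diff[OF Q_along_characteristic[OF u, of 0 1 s] Q_along_characteristic[OF t, of 0 1 s]] s
      by (simp add: D_def)
    ultimately show "(D has_real_derivative a s * D s + (d u s - d t s)) (at s within {0..1})"
      by (auto simp: d_def elim!: DERIV_cong)
  qed (use a_cont in auto)
  have D_zero: "D 0 = 0" "D 1 = 0"
    using t u by (auto simp: D_def Q_left Q_right)
  have int_E: "((\<lambda>s. exp (- A s) * (d u s - d t s)) has_integral
      integral {0..1} (\<lambda>s. exp (- A s) * d u s) - integral {0..1} (\<lambda>s. exp (- A s) * d t s)) {0..1}"
    using has_integral_diff[OF E_int[OF u] E_int[OF t]] by (simp add: algebra_simps)
  have eq: "integral {0..1} (\<lambda>s. exp (- A s) * d u s) = integral {0..1} (\<lambda>s. exp (- A s) * d t s)"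
    using has_integral_unique[OF int_D int_E] D_zero by simp
  have "exp (- L) * integral {0..1} (d u) \<le> integral {0..1} (\<lambda>s. exp (- A s) * d u s)"
    using d_int[OF u] E_int[OF u]
    by (rule has_integral_le) (use A_le d_nonneg u in \<open>force intro!: mult_right_mono\<close>)
  also have "\<dots> \<le> exp L * integral {0..1} (d t)"
    unfolding eq using E_int[OF t] d_int[OF t]
    by (rule has_integral_le) (use A_le d_nonneg t in \<open>force intro!: mult_right_mono\<close>)
  finally have "exp L * (exp (- L) * integral {0..1} (d u)) \<le> exp L * (exp L * integral {0..1} (d t))"
    by simp
  then have "integral {0..1} (d u) \<le> exp L * exp L * integral {0..1} (d t)"
    by (simp only: mult.assoc[symmetric] exp_minus_inverse mult_1)
  then show ?thesis unfolding d_def by (simp only: mult_2 exp_add)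
qed

text \<open>
  The window starting at \<open>u\<close> is compared with windows whose starting value of \<open>c\<close> approaches the
  infimum; the integral of \<open>c - m\<close> over the latter tends to zero.
\<close>

lemma c_constant:
  assumes u: "u \<in> {0..}"
  shows "c u = (INF t\<in>{0..}. c t)"
proof -
  define m where "m = (INF t\<in>{0..}. c t)"
  have m: "m \<le> c t" if "t \<in> {0..}" for t
    unfolding m_def using that c_pos by (intro cINF_lower bdd_belowI2[of _ 0]) (auto intro: less_imp_le)
  let ?I = "integral {0..1} (\<lambda>s. c (u + s) - m)"
  have cont: "continuous_on {0..1} (\<lambda>s. c (u + s) - m)"
    using u by (intro continuous_intros continuous_on_compose2[OF c_cont]) auto
  have nonneg: "0 \<le> c (u + s) - m" if "s \<in> {0..1}" for s
    using m[of "u + s"] u that by auto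
  have "?I \<le> 0 + \<epsilon>" if \<epsilon>: "\<epsilon> > 0" for \<epsilon>
  proof -
    \<comment> \<open>The two estimates lose the factors \<open>exp L / k\<close> and \<open>exp (2 L)\<close>.\<close>
    define \<delta> where "\<delta> = \<epsilon> * k / (exp (2 * L) * exp L)"
    have "\<delta> > 0" using \<epsilon> k_pos by (simp add: \<delta>_def)
    then have "(INF t\<in>{0..}. c t) < m + \<delta>" by (simp add: m_def)
    then obtain t where t: "t \<in> {0..}" "c t < m + \<delta>"
      using cInf_lessD[of "c ` {0..}"] by auto
    have "?I \<le> exp (2 * L) * integral {0..1} (\<lambda>s. c (t + s) - m)"
      by (rule window_comparison[OF m t(1) u])
    also have "\<dots> \<le> exp (2 * L) * (exp L / k * (c t - m))"
      by (intro mult_left_mono near_infimum_window[OF m t(1)]) auto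
    also have "\<dots> \<le> exp (2 * L) * (exp L / k * \<delta>)"
      using t(2) k_pos by (intro mult_left_mono) auto
    also have "\<dots> = \<epsilon>" using k_pos by (simp add: \<delta>_def)
    finally show ?thesis by simp
  qed
  then have "?I \<le> 0" by (rule field_le_epsilon)
  moreover have "0 \<le> ?I"
    using nonneg by (intro integral_nonneg integrable_continuous_real cont) auto
  ultimately have "?I = 0" by simp
  then have "c (u + 0) - m = 0"
    using integral_eq_0_iff[OF cont] nonneg by force
  then show ?thesis by (simp add: m_def)
qed

text \<open>
  With \<open>c\<close> constant, \<open>Q\<^sub>\<tau>\<close> solves a homogeneous linear equation along the characteristic through
  \<open>(t,e)\<close>, which leaves the strip at \<open>(t + 1 - e, 1)\<close>, where \<open>Q\<^sub>\<tau>\<close> vanishes. Working backwards from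
  the exit, rather than forwards from \<open>\<eta> = 0\<close>, also covers the characteristics that start inside
  the strip at time \<open>0\<close>.
\<close>

lemma Q_time_derivative_zero:
  assumes t: "t \<in> {0..}" and e: "e \<in> {0..1}"
  shows "Q\<^sub>\<tau> t e = 0"
proof -
  let ?m = "INF t\<in>{0..}. c t"
  have flux: "Q\<^sub>\<tau> (t + s) (e + s) = ?m - (c (t + s) - Q\<^sub>\<tau> (t + s) (e + s))" if "s \<in> {0..1 - e}" for s
    using c_constant[of "t + s"] t that by auto
  have "((\<lambda>s. Q\<^sub>\<tau> (t + s) (e + s)) has_real_derivative
      K' (Q (t + s) (e + s)) * Q\<^sub>\<tau> (t + s) (e + s)) (at s within {0..1 - e})"
    if s: "s \<in> {0..1 - e}" for s
  proof (rule has_real_derivative_cong_on[OF s flux])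
    have "((\<lambda>s. c (t + s) - Q\<^sub>\<tau> (t + s) (e + s)) has_real_derivative
        - (K' (Q (t + s) (e + s)) * Q\<^sub>\<tau> (t + s) (e + s))) (at s within {0..1 - e})"
      using s by (intro flux_along_characteristic t e) auto
    from DERIV_diff[OF DERIV_const[of ?m] this]
    show "((\<lambda>s. ?m - (c (t + s) - Q\<^sub>\<tau> (t + s) (e + s))) has_real_derivative
        K' (Q (t + s) (e + s)) * Q\<^sub>\<tau> (t + s) (e + s)) (at s within {0..1 - e})"
      by simp
  qed
  moreover have "continuous_on {0..1 - e} (\<lambda>s. K' (Q (t + s) (e + s)))" using t e
    by (intro continuous_on_compose2[OF K'_cont] continuous_on_along[OF Q_cont] continuous_intros) auto
  ultimately have "Q\<^sub>\<tau> (t + (1 - e)) (e + (1 - e)) = 0 \<longleftrightarrow> Q\<^sub>\<tau> (t + 0) (e + 0) = 0"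
    using e by (intro homogeneous_linear_ode_zero_iff) auto
  then show ?thesis using Q_right_derivative[of "t + (1 - e)"] t e by simp
qed

theorem stationary:
  assumes t: "t \<in> {0..}"
  shows "c t = c 0" "e \<in> {0..1} \<Longrightarrow> Q t e = Q 0 e"
proof -
  show "c t = c 0" 
    by (rule trans[OF c_constant[OF t] c_constant[symmetric]]) simp
  assume e: "e \<in> {0..1}"
  have "\<exists>q. \<forall>t\<in>{0..}. Q t e = q"
    using Q\<^sub>\<tau>[OF _ e] Q_time_derivative_zero[OF _ e]
    by (intro has_field_derivative_zero_constant) auto
  then show "Q t e = Q 0 e" using t by auto
qed

end

section \<open>Steady states\<close>

text \<open>
  The difference of two steady states solves a linear equation with constant inhomogeneity
  \<open>1/N1 - 1/N2\<close> and vanishes at both ends of \<open>[0,1]\<close>, so the inhomogeneity must vanish.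
\<close>

lemma steady_state_unique:
  assumes K: "\<And>x. (K has_real_derivative K' x) (at x)" and K': "continuous_on UNIV K'"
    and 1: "steady_state K \<Phi>F Q1 N1" and 2: "steady_state K \<Phi>F Q2 N2"
  shows "N1 = N2" "\<eta> \<in> {0..1} \<Longrightarrow> Q1 \<eta> = Q2 \<eta>"
proof -
  define a where "a = (\<lambda>s. mean_slope K' (Q2 s) (Q1 s))"
  let ?D = "\<lambda>s. Q1 s - Q2 s" and ?E = "\<lambda>s. exp (- integral {0..s} a)"
  have Qd: "(Q1 has_real_derivative K (Q1 s) + 1 / N1) (at s within {0..1})"
      "(Q2 has_real_derivative K (Q2 s) + 1 / N2) (at s within {0..1})" if "s \<in> {0..1}" for s
    using 1 2 that by (auto simp: steady_state_def C1_on_def)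
  have a_cont: "continuous_on {0..1} a" unfolding a_def
    using Qd by (intro continuous_on_mean_slope K' DERIV_continuous_on)
  have D: "(?D has_real_derivative a s * ?D s + (1 / N1 - 1 / N2)) (at s within {0..b})"
    if "s \<in> {0..b}" "b \<in> {0..1}" for s b
  proof -
    have "(?D has_real_derivative K (Q1 s) + 1 / N1 - (K (Q2 s) + 1 / N2)) (at s within {0..b})"
      using that by (intro DERIV_subset[OF DERIV_diff[OF Qd]]) auto
    moreover have "a s * ?D s = K (Q1 s) - K (Q2 s)"
      unfolding a_def by (rule mean_slope[OF K K', symmetric])
    ultimately show ?thesis by (simp add: add_diff_add)
  qed
  have "((\<lambda>s. ?E s * (1 / N1 - 1 / N2)) has_integral ?E 1 * ?D 1 - ?D 0) {0..1}"
    using a_cont D by (intro linear_ode_variation_of_constants) auto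
  moreover have "?D 0 = 0" "?D 1 = 0" using 1 2 by (auto simp: steady_state_def)
  moreover have E_cont: "continuous_on {0..1} ?E"
    by (intro continuous_intros indefinite_integral_continuous_1 integrable_continuous_real a_cont)
  ultimately have "integral {0..1} ?E * (1 / N1 - 1 / N2) = 0"
    by (simp flip: integral_mult_left add: integral_unique)
  moreover have "integral {0..1} ?E \<noteq> 0"
    using integral_eq_0_iff[OF E_cont] by force
  ultimately show N: "N1 = N2" by simp
  assume \<eta>: "\<eta> \<in> {0..1}"
  have "?D \<eta> = 0 \<longleftrightarrow> ?D 0 = 0"
  proof (rule homogeneous_linear_ode_zero_iff)
    show "(?D has_real_derivative a s * ?D s) (at s within {0..\<eta>})" if "s \<in> {0..\<eta>}" for s
      using D[OF that \<eta>] N by simp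
  qed (use \<eta> in \<open>auto intro: continuous_on_subset[OF a_cont]\<close>)
  then show "Q1 \<eta> = Q2 \<eta>" using \<open>?D 0 = 0\<close> by simp
qed

lemma time_interval_infinity: "time_interval \<infinity> = {0..}"
  by (auto simp: time_interval_def)

lemma steady_state_imp_global_solution:
  assumes ss: "steady_state K \<Phi>F Qs Ns" and mono: "mono_on {0..1} Qs"
    and init: "\<And>\<eta>. \<eta> \<in> {0..1} \<Longrightarrow> Qinit \<eta> = Qs \<eta>"
  shows "classical_solution K \<Phi>F \<infinity> Qinit (\<lambda>_. Qs) (\<lambda>_. Ns)"
proof -
  have Qs: "\<And>s. s \<in> {0..1} \<Longrightarrow> (Qs has_real_derivative K (Qs s) + 1 / Ns) (at s within {0..1})"
    and cont: "continuous_on {0..1} (\<lambda>\<eta>. K (Qs \<eta>) + 1 / Ns)"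
    and Ns: "Ns > 0" "Qs 0 = 0" "Qs 1 = \<Phi>F"
    using ss by (auto simp: steady_state_def C1_on_def)
  have "continuous_on ({0..} \<times> {0..1}) (\<lambda>p::real \<times> real. F (snd p))"
    if "continuous_on {0..1} F" for F :: "real \<Rightarrow> real"
    by (rule continuous_on_compose2[OF that]) (auto intro: continuous_intros)
  from this[OF DERIV_continuous_on[OF Qs]] this[OF cont]
  have "C1_strip \<infinity> (\<lambda>_. Qs) (\<lambda>_ _. 0) (\<lambda>_ \<eta>. K (Qs \<eta>) + 1 / Ns)"
    using Qs by (auto simp: C1_strip_def time_interval_infinity split_beta)
  then show ?thesis
    unfolding classical_solution_def using mono Ns init
    by (intro conjI exI[of _ "\<lambda>_ _. 0"] exI[of _ "\<lambda>_ \<eta>. K (Qs \<eta>) + 1 / Ns"]) auto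
qed

text \<open>
  On the way from \<open>0\<close> to \<open>x\<close> the derivative of \<open>K\<close> cannot drop by more than the total integral of
  the negative part of its own derivative.
\<close>

lemma k_min_le_deriv:
  assumes "standing_assumptions K \<Phi>F" and x: "x \<in> {0..\<Phi>F}"
  shows "k_min K \<Phi>F \<le> deriv K x"
proof -
  let ?K2 = "deriv (deriv K)"
  have K'': "(deriv K has_real_derivative ?K2 y) (at y)" for y
    using assms by (metis UNIV_I differentiable_on_def differentiable_iff_scaleR DERIV_deriv_iff_real_differentiable
        standing_assumptions_def)
  have cont: "continuous_on A (\<lambda>y. min (?K2 y) 0)" for A
    using assms by (auto simp: standing_assumptions_def
        intro!: continuous_intros elim: continuous_on_subset)
  note int = integrable_continuous_real[OF cont]
  have "(?K2 has_integral deriv K x - deriv K 0) {0..x}"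
    using x K'' by (intro fundamental_theorem_of_calculus)
      (auto simp flip: has_real_derivative_iff_has_vector_derivative intro: has_field_derivative_at_within)
  then have "integral {0..x} (\<lambda>y. min (?K2 y) 0) \<le> deriv K x - deriv K 0"
    by (intro has_integral_le[OF integrable_integral[OF int]]) auto
  moreover have "integral {x..\<Phi>F} (\<lambda>y. min (?K2 y) 0) \<le> integral {x..\<Phi>F} (\<lambda>_. 0)"
    by (intro integral_le int) auto
  moreover have "integral {0..x} (\<lambda>y. min (?K2 y) 0) + integral {x..\<Phi>F} (\<lambda>y. min (?K2 y) 0)
      = integral {0..\<Phi>F} (\<lambda>y. min (?K2 y) 0)"
    using x by (intro Henstock_Kurzweil_Integration.integral_combine int) auto
  ultimately show ?thesis by (simp add: k_min_def)
qed

section \<open>Blow-up\<close>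

theorem theorem6p1:
  fixes K :: "real \<Rightarrow> real" and \<Phi>F :: real and Qinit :: "real \<Rightarrow> real"
    and Q :: "real \<Rightarrow> real \<Rightarrow> real" and N :: "real \<Rightarrow> real"
  assumes "standing_assumptions K \<Phi>F"
    and "k_min K \<Phi>F > 0"
    and "initial_datum K \<Phi>F Qinit"
    and "maximal_classical_solution K \<Phi>F Qinit Q N"
  shows "blows_up_in_finite_time K \<Phi>F Qinit \<longleftrightarrow>
    \<not> (\<exists>Qs Ns. unique_steady_state K \<Phi>F Qs Ns \<and>
         (\<forall>\<tau>\<in>time_interval (max_time K \<Phi>F Qinit).
            N \<tau> = Ns \<and> (\<forall>\<eta>\<in>{0..1}. Q \<tau> \<eta> = Qs \<eta>)))"
proof -
  let ?T = "max_time K \<Phi>F Qinit"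
  have sol: "classical_solution K \<Phi>F ?T Qinit Q N"
    using assms(4) by (simp add: maximal_classical_solution_def)
  have K: "(K has_real_derivative deriv K x) (at x)"
    and K': "(deriv K has_real_derivative deriv (deriv K) x) (at x)" for x
    using assms(1) by (metis UNIV_I differentiable_on_def DERIV_deriv_iff_real_differentiable
        standing_assumptions_def)+
  have K'_cont: "continuous_on UNIV (deriv K)"
    using K' by (meson DERIV_continuous continuous_at_imp_continuous_on)
  have global: "?T = \<infinity>"
    if ss: "unique_steady_state K \<Phi>F Qs Ns"
      and eq: "\<forall>\<tau>\<in>time_interval ?T. N \<tau> = Ns \<and> (\<forall>\<eta>\<in>{0..1}. Q \<tau> \<eta> = Qs \<eta>)" for Qs Ns
  proof -
    have 0: "0 \<in> time_interval ?T"
      using sol by (simp add: classical_solution_def time_interval_def flip: zero_ereal_def)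
    have "mono_on {0..1} (Q 0)" "\<forall>\<eta>\<in>{0..1}. Q 0 \<eta> = Qinit \<eta>"
      using sol 0 unfolding classical_solution_def by blast+
    then have "classical_solution K \<Phi>F \<infinity> Qinit (\<lambda>_. Qs) (\<lambda>_. Ns)"
      using ss eq 0 by (intro steady_state_imp_global_solution)
        (auto simp: unique_steady_state_def mono_on_def)
    then have "\<infinity> \<le> ?T" unfolding max_time_def by (intro Sup_upper) blast
    then show ?thesis by simp
  qed
  have steady: "\<exists>Qs Ns. unique_steady_state K \<Phi>F Qs Ns \<and>
      (\<forall>\<tau>\<in>time_interval ?T. N \<tau> = Ns \<and> (\<forall>\<eta>\<in>{0..1}. Q \<tau> \<eta> = Qs \<eta>))" if T: "?T = \<infinity>"
  proof -
    obtain L where L: "\<And>x. \<bar>deriv K x\<bar> \<le> L"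
      using assms(1) by (auto simp: standing_assumptions_def bounded_iff)
    from sol obtain Q\<^sub>\<tau> Q\<^sub>\<eta> where strip: "C1_strip \<infinity> Q Q\<^sub>\<tau> Q\<^sub>\<eta>"
      and sys: "\<forall>\<tau>\<in>{0..}. mono_on {0..1} (Q \<tau>)" "continuous_on {0..} N" "\<forall>\<tau>\<in>{0..}. N \<tau> > 0"
        "\<forall>\<tau>\<in>{0..}. \<forall>\<eta>\<in>{0<..<1}. Q\<^sub>\<tau> \<tau> \<eta> + Q\<^sub>\<eta> \<tau> \<eta> = 1 / N \<tau> + K (Q \<tau> \<eta>)"
        "\<forall>\<tau>\<in>{0..}. Q \<tau> 0 = 0" "\<forall>\<tau>\<in>{0..}. 1 / N \<tau> = Q\<^sub>\<eta> \<tau> 1 - K \<Phi>F"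
        "\<forall>\<eta>\<in>{0..1}. Q 0 \<eta> = Qinit \<eta>"
      unfolding classical_solution_def T time_interval_infinity by blast
    interpret global_solution K "deriv K" \<Phi>F L "k_min K \<Phi>F" Q Q\<^sub>\<tau> Q\<^sub>\<eta> "\<lambda>\<tau>. 1 / N \<tau>"
    proof
      show "continuous_on {0..} (\<lambda>\<tau>. 1 / N \<tau>)"
        using sys(2,3) by (intro continuous_on_divide continuous_on_const) (auto simp: less_imp_neq[symmetric])
      show "1 / N t > 0" if "t \<in> {0..}" for t using sys(3) that by simp
      show "Q 0 1 = \<Phi>F" using sys(7) assms(3) by (simp add: initial_datum_def)
    qed (use strip sys K K'_cont L assms(2) k_min_le_deriv[OF assms(1)] in
        \<open>auto simp: C1_strip_def time_interval_infinity\<close>)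
    have "(Q 0 has_real_derivative K (Q 0 \<eta>) + 1 / N 0) (at \<eta> within {0..1})"
      if "\<eta> \<in> {0..1}" for \<eta>
      using Q\<^sub>\<eta>[of 0 \<eta>] pde[of 0 \<eta>] Q_time_derivative_zero[of 0 \<eta>] that
      by (simp add: add.commute)
    moreover from this have "continuous_on {0..1} (\<lambda>\<eta>. K (Q 0 \<eta>) + 1 / N 0)"
      by (intro continuous_intros continuous_on_compose2[OF K_cont[of UNIV]] DERIV_continuous_on) auto
    ultimately have ss: "steady_state K \<Phi>F (Q 0) (N 0)"
      using sys(3) Q_left[of 0] Q_right[of 0] by (simp add: steady_state_def C1_on_def)
    then have "unique_steady_state K \<Phi>F (Q 0) (N 0)"
      using steady_state_unique[OF K K'_cont] by (auto simp: unique_steady_state_def)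
    moreover have "N \<tau> = N 0 \<and> (\<forall>\<eta>\<in>{0..1}. Q \<tau> \<eta> = Q 0 \<eta>)" if "\<tau> \<in> {0..}" for \<tau>
      using stationary[OF that] by simp
    ultimately show ?thesis unfolding T time_interval_infinity by blast
  qed
  have "blows_up_in_finite_time K \<Phi>F Qinit \<longleftrightarrow> ?T \<noteq> \<infinity>"
    by (simp add: blows_up_in_finite_time_def less_top[symmetric] top_ereal_def)
  then show ?thesis using global steady by blast
qed

end
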